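(* Let $\mathcal{R}$ and $\mathcal{R}'$ be two rings. Suppose that $\mathcal{R}$ is a $2$-torsion free unital ring containing a nontrivial idempotent $e_1$; put $e_2=1-e_1$, and suppose that for all $a\in\mathcal{R}$ and all $i,j,k\in\{1,2\}$: if $e_iae_j\mathcal{R}e_k=\{0\}$ or $e_k\mathcal{R}e_iae_j=\{0\}$, then $e_iae_j=0$. Suppose that $M\colon\mathcal{R}\to\mathcal{R}'$ and $M^*\colon\mathcal{R}'\to\mathcal{R}$ are surjective maps such that $$M(aM^*(x)b+bM^*(x)a)=M(a)xM(b)+M(b)xM(a),$$ $$M^*(xM(a)y+yM(a)x)=M^*(x)aM^*(y)+M^*(y)aM^*(x)$$ for all $a,b\in\mathcal{R}$ and $x,y\in\mathcal{R}'$. Then both $M$ and $M^*$ are additive, i.e. $M(a+b)=M(a)+M(b)$ for all $a,b\in\mathcal{R}$ and $M^*(x+y)=M^*(x)+M^*(y)$ for all $x,y\in\mathcal{R}'$.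
   Context: Rings are associative; $\mathcal{R}'$ need not be unital. $M^*$ is just the name of a second map (not an adjoint); neither map is assumed additive. A ring is $2$-torsion free if $2a=0$ implies $a=0$. An idempotent $e_1$ is nontrivial if $e_1\neq 0$ and $e_1\neq 1$. *)

theory Defs imports Main begin

end

(* Put K = Mstar^-1 and {a, r, b} = a r b + b r a. Then M and K are bijections satisfying
   M {a, r, b} = {M a, K r, M b} and K {a, r, b} = {K a, M r, K b}. Given a and b, choose s with
   M s = M a + M b; then M {s, r, t} = M {a, r, t} + M {b, r, t} and
   K {r, s, t} = K {r, a, t} + K {r, b, t} for all r, t. Choosing r and t so that one summand
   vanishes, injectivity determines the Peirce components of s, and s = a + b. *)

theory Submission imports Defs begin

section \<open>The Jordan triple product\<close>

definition jtriple :: "'a::ring \<Rightarrow> 'a \<Rightarrow> 'a \<Rightarrow> 'a" where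
  "jtriple a r b = a * r * b + b * r * a"

lemma jtriple_zero [simp]:
  "jtriple 0 r b = 0" "jtriple a 0 b = 0" "jtriple a r 0 = 0"
  by (simp_all add: jtriple_def)

lemma jtriple_add:
  "jtriple (a + a') r b = jtriple a r b + jtriple a' r b"
  "jtriple a (r + r') b = jtriple a r b + jtriple a r' b"
  "jtriple a r (b + b') = jtriple a r b + jtriple a r b'"
  by (simp_all add: jtriple_def algebra_simps)

lemma jtriple_one: "jtriple 1 a 1 = a + (a::'a::ring_1)"
  by (simp add: jtriple_def)

text \<open>\<open>K\<close> stands for the inverse of \<open>Mstar\<close>. With it both identities
  say that a triple is preserved, one map acting on the outer slots and the other on the middle
  slot. The Peirce condition is phrased for an \<open>a\<close> that already lies in a
  corner.\<close>

locale jordan_elementary =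
  fixes M K :: "'r::ring_1 \<Rightarrow> 's::ring"
    and e f :: 'r
  assumes double_zero: "a + a = 0 \<Longrightarrow> a = (0::'r)"
    and bij_M: "bij M" and bij_K: "bij K"
    and M_jtriple: "M (jtriple a r b) = jtriple (M a) (K r) (M b)"
    and K_jtriple: "K (jtriple a r b) = jtriple (K a) (M r) (K b)"
    and ee: "e * e = e" and sum_one: "e + f = 1"
    and peirce: "\<lbrakk>p \<in> {e, f}; q \<in> {e, f}; k \<in> {e, f}; p * a * q = a; \<And>r. a * r * k = 0\<rbrakk> \<Longrightarrow> a = 0"
begin

lemma idempotents:
  "f * f = f" "e * f = 0" "f * e = 0"
proof -
  have f: "f = 1 - e" using sum_one by (simp add: algebra_simps)
  show "f * f = f" "e * f = 0" "f * e = 0"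
    by (simp_all add: f algebra_simps ee)
qed

text \<open>As \<open>f = 1 - e\<close> is idempotent too, the setting is symmetric in
  \<open>e\<close> and \<open>f\<close>, so every corner result has a mirror image.\<close>

lemma swap: "jordan_elementary M K f e"
proof (unfold_locales)
  show "f + e = 1" using sum_one by (simp add: add.commute)
  show "a = 0" if "p \<in> {f, e}" "q \<in> {f, e}" "k \<in> {f, e}" "p * a * q = a" "\<And>r. a * r * k = 0"
    for p q k a
    using peirce[of p q k a] that by blast
qed (fact double_zero bij_M bij_K M_jtriple K_jtriple idempotents(1))+

lemma double_eq_zero: "a + a = 0 \<longleftrightarrow> a = (0::'r)"
  using double_zero[of a] by auto

lemma double_inject: "a + a = b + b \<Longrightarrow> a = (b::'r)"
  using double_zero[of "a - b"] by (simp add: algebra_simps)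

lemma M_inject: "M a = M b \<longleftrightarrow> a = b" and K_inject: "K a = K b \<longleftrightarrow> a = b"
  using bij_M bij_K by (auto simp: bij_def inj_eq)

lemma M_zero: "M 0 = 0"
proof -
  \<comment> \<open>This \<open>z\<close> puts a zero into the middle slot of the image
    triple.\<close>
  obtain z where "K z = 0" using bij_K by (metis bij_pointE)
  then show ?thesis using M_jtriple[of 0 z 0] by simp
qed

lemma K_zero: "K 0 = 0"
proof -
  obtain z where "M z = 0" using bij_M by (metis bij_pointE)
  then show ?thesis using K_jtriple[of 0 z 0] by simp
qed

text \<open>The triple is additive in each slot. The \<open>M\<close> identity tests
  \<open>s\<close> in an outer slot, the \<open>K\<close> identity tests it in the middle
  slot.\<close>

lemma obtain_sum:
  obtains s where
    "M s = M a + M b"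
    "\<And>r t. M (jtriple s r t) = M (jtriple a r t) + M (jtriple b r t)"
    "\<And>r t. K (jtriple r s t) = K (jtriple r a t) + K (jtriple r b t)"
proof -
  obtain s where "M s = M a + M b" using bij_M by (metis bij_pointE)
  then show thesis using that[of s] by (simp add: M_jtriple K_jtriple jtriple_add)
qed

section \<open>Peirce decomposition and elements with disjoint components\<close>

lemma peirce_decomp: "e * a * e + f * a * f + (e * a * f + f * a * e) = a"
proof -
  have "e * a * e + f * a * f + (e * a * f + f * a * e) = (e + f) * a * (e + f)"
    by (simp add: algebra_simps)
  then show ?thesis by (simp add: sum_one)
qed

text \<open>The middle-slot tests {e, s, e}, {f, s, f} and {e, s, f} read off the two diagonal
  components (doubled) and the sum of the off-diagonal ones. In each test \<open>a\<close> or
  \<open>b\<close> contributes zero, and \<open>K 0 = 0\<close>.\<close>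

lemma M_add_disjoint:
  assumes "e * a * e = 0 \<or> e * b * e = 0" "f * a * f = 0 \<or> f * b * f = 0"
    and "e * a * f + f * a * e = 0 \<or> e * b * f + f * b * e = 0"
  shows "M (a + b) = M a + M b"
proof -
  obtain s where s: "M s = M a + M b"
    and K: "\<And>r t. K (jtriple r s t) = K (jtriple r a t) + K (jtriple r b t)"
    using obtain_sum[of a b] by metis
  have K': "jtriple r s t = jtriple r (a + b) t"
    if "jtriple r a t = 0 \<or> jtriple r b t = 0" for r t
  proof -
    have "K (jtriple r s t) = K (jtriple r (a + b) t)"
      using K[of r t] that by (auto simp: K_zero jtriple_add)
    then show ?thesis by (simp add: K_inject)
  qed
  have "e * s * e = e * (a + b) * e"
    using K'[of e e] assms(1) by - (rule double_inject, auto simp: jtriple_def)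
  moreover have "f * s * f = f * (a + b) * f"
    using K'[of f f] assms(2) by - (rule double_inject, auto simp: jtriple_def)
  moreover have "e * s * f + f * s * e = e * (a + b) * f + f * (a + b) * e"
    using K'[of e f] assms(3) by (auto simp: jtriple_def)
  ultimately have "s = a + b"
    using peirce_decomp[of s] peirce_decomp[of "a + b"] by metis
  then show ?thesis using s by simp
qed

section \<open>Additivity of \<open>M\<close> inside the Peirce corners\<close>

lemma corner_ef:
  assumes "e * a * f = a"
  shows "e * a = a" "a * f = a" "f * a = 0" "a * e = 0"
proof -
  have left: "e * (e * a * f) = e * a * f" "f * (e * a * f) = 0"
    by (simp_all add: mult.assoc[symmetric] ee idempotents)
  have right: "(e * a * f) * f = e * a * f" "(e * a * f) * e = 0"
    by (simp_all add: mult.assoc ee idempotents)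
  show "e * a = a" "a * f = a" "f * a = 0" "a * e = 0"
    by (fact left[unfolded assms] right[unfolded assms])+
qed

lemma corner_ee:
  assumes "e * a * e = a"
  shows "e * a = a" "a * e = a" "f * a = 0" "a * f = 0"
proof -
  have left: "e * (e * a * e) = e * a * e" "f * (e * a * e) = 0"
    by (simp_all add: mult.assoc[symmetric] ee idempotents)
  have right: "(e * a * e) * e = e * a * e" "(e * a * e) * f = 0"
    by (simp_all add: mult.assoc ee idempotents)
  show "e * a = a" "a * e = a" "f * a = 0" "a * f = 0"
    by (fact left[unfolded assms] right[unfolded assms])+
qed

text \<open>Taking \<open>t = f * r * e\<close> with \<open>r\<close> arbitrary gives
  \<open>(s - a) * r * e = 0\<close>, because \<open>s\<close> and \<open>a\<close> absorb
  \<open>f\<close> on the right; the Peirce condition then forces \<open>s - a = 0\<close>.\<close>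

lemma corner_ef_eqI:
  assumes a: "e * a * f = a" and s: "e * s * f = s"
    and eq: "\<And>t. f * t * e = t \<Longrightarrow> s * t = a * t"
  shows "s = a"
proof -
  have "(s - a) * r * e = 0" for r
  proof -
    have "s * (f * r * e) = a * (f * r * e)"
      by (rule eq) (metis ee idempotents(1) mult.assoc)
    then have "s * r * e = a * r * e"
      using corner_ef(2)[OF a] corner_ef(2)[OF s] by (metis mult.assoc)
    then show ?thesis by (simp add: algebra_simps)
  qed
  then show ?thesis
    using peirce[of e f e "s - a"] a s by (simp add: algebra_simps)
qed

lemma corner_ee_eqI:
  assumes a: "e * a * e = a" and s: "e * s * e = s"
    and eq: "\<And>t. e * t * f = t \<Longrightarrow> s * t = a * t"
  shows "s = a"
proof -
  have "(s - a) * r * f = 0" for r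
  proof -
    have "s * (e * r * f) = a * (e * r * f)"
      by (rule eq) (metis ee idempotents(1) mult.assoc)
    then have "s * r * f = a * r * f"
      using corner_ee(2)[OF a] corner_ee(2)[OF s] by (metis mult.assoc)
    then show ?thesis by (simp add: algebra_simps)
  qed
  then show ?thesis
    using peirce[of e e f "s - a"] a s by (simp add: algebra_simps)
qed

lemma corner_ef_of_sum:
  assumes M: "\<And>r t. M (jtriple s r t) = M (jtriple a r t) + M (jtriple b r t)"
    and a: "e * a * f = a" and b: "f * b * e = b"
  shows "e * s * f = a"
proof (rule corner_ef_eqI[OF a])
  show "e * (e * s * f) * f = e * s * f" by (metis ee idempotents(1) mult.assoc)
  interpret swap: jordan_elementary M K f e by (rule swap)
  fix t assume t: "f * t * e = t"
  note simps = corner_ef[OF a] swap.corner_ef[OF b] swap.corner_ef[OF t]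
  \<comment> \<open>Both \<open>b\<close> and \<open>t\<close> are annihilated by \<open>f\<close>
    on the right. So the test with \<open>r = f\<close> removes \<open>b\<close>, and below it also
    removes the terms beginning with \<open>t * f\<close>.\<close>
  have "jtriple b f t = 0" by (simp add: jtriple_def simps mult.assoc)
  then have "jtriple s f t = jtriple a f t"
    using M[of f t] by (simp add: M_zero M_inject)
  then have "s * t = a * t - t * f * s + t * f * a"
    using simps by (simp add: jtriple_def mult.assoc algebra_simps)
  then have "s * t = a * t" using simps by (simp add: mult.assoc)
  then show "e * s * f * t = a * t" using simps by (simp add: mult.assoc) (metis mult.assoc)
qed

text \<open>Middle-slot tests see only the sum of the two off-diagonal components, so they settle
  just the diagonal of \<open>s\<close>; the outer-slot tests separate the other two.\<close>

lemma M_add_opposite: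
  assumes a: "e * a * f = a" and b: "f * b * e = b"
  shows "M (a + b) = M a + M b"
proof -
  interpret swap: jordan_elementary M K f e by (rule swap)
  obtain s where s: "M s = M a + M b"
    and M: "\<And>r t. M (jtriple s r t) = M (jtriple a r t) + M (jtriple b r t)"
    and K: "\<And>r t. K (jtriple r s t) = K (jtriple r a t) + K (jtriple r b t)"
    using obtain_sum[of a b] by metis
  note simps = corner_ef[OF a] swap.corner_ef[OF b]
  have "jtriple e s e = 0" "jtriple f s f = 0"
    using K[of e e] K[of f f] K_inject[of _ 0]
    by (simp_all add: jtriple_def simps mult.assoc K_zero)
  then have "e * s * e = 0" "f * s * f = 0"
    by (simp_all add: jtriple_def double_eq_zero)
  moreover have "e * s * f = a" by (rule corner_ef_of_sum[OF M a b])
  moreover have "f * s * e = b"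
    by (rule swap.corner_ef_of_sum[OF _ b a]) (simp add: M add.commute)
  ultimately have "s = a + b" using peirce_decomp[of s] by simp
  then show ?thesis using s by simp
qed

text \<open>The trick is \<open>a + b = {e + a, 1, f + b}\<close>, which expands by additivity on disjoint components.\<close>

lemma M_add_ef:
  assumes a: "e * a * f = a" and b: "e * b * f = b"
  shows "M (a + b) = M a + M b"
proof -
  note simps = corner_ef[OF a] corner_ef[OF b] ee idempotents
  have ab: "a * b = 0" "b * a = 0"
    using simps by (metis mult.assoc mult_zero_left mult_zero_right)+
  have "M (e + a) = M e + M a" "M (f + b) = M f + M b"
    by (intro M_add_disjoint; simp add: simps mult.assoc)+
  moreover have "jtriple (e + a) 1 (f + b) = a + b"
    by (simp add: jtriple_def simps ab algebra_simps)
  ultimately have "M (a + b) = M (jtriple e 1 f) + M (jtriple e 1 b) + M (jtriple a 1 f) + M (jtriple a 1 b)"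
    by (metis (no_types, lifting) M_jtriple jtriple_add(1,3) add.assoc)
  then show ?thesis by (simp add: jtriple_def simps ab M_zero add.commute)
qed

text \<open>Right multiplication by an element of the \<open>e\<close>-\<open>f\<close> corner moves
  the claim into that corner, where additivity is known.\<close>

lemma M_add_ee:
  assumes a: "e * a * e = a" and b: "e * b * e = b"
  shows "M (a + b) = M a + M b"
proof -
  obtain s where s: "M s = M a + M b"
    and M: "\<And>r t. M (jtriple s r t) = M (jtriple a r t) + M (jtriple b r t)"
    and K: "\<And>r t. K (jtriple r s t) = K (jtriple r a t) + K (jtriple r b t)"
    using obtain_sum[of a b] by metis
  note simps = corner_ee[OF a] corner_ee[OF b]
  have "jtriple f s f = 0" "jtriple e s f = 0"
    using K[of f f] K[of e f] K_inject[of _ 0]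
    by (simp_all add: jtriple_def simps mult.assoc K_zero)
  \<comment> \<open>The off-diagonal components vanish as a sum, which is all that the decomposition
    of \<open>s\<close> requires.\<close>
  then have s_ee: "e * s * e = s"
    using peirce_decomp[of s] by (simp add: jtriple_def double_eq_zero)
  have "s = a + b"
  proof (rule corner_ee_eqI[OF _ s_ee])
    show "e * (a + b) * e = a + b" using a b by (simp add: algebra_simps)
    fix t assume t: "e * t * f = t"
    \<comment> \<open>Since \<open>t * e = 0\<close>, the triple collapses to a plain
      product.\<close>
    have prod: "jtriple c e t = c * t" "e * (c * t) * f = c * t" if c: "e * c * e = c" for c
      using corner_ee[OF c] corner_ef[OF t]
      by (simp_all add: jtriple_def mult.assoc) (metis mult.assoc)
    have "M (s * t) = M (a * t) + M (b * t)"
      using M[of e t] by (simp add: prod a b s_ee)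
    also have "\<dots> = M ((a + b) * t)"
      using M_add_ef[of "a * t" "b * t"] prod(2)[OF a] prod(2)[OF b] by (simp add: distrib_right)
    finally show "s * t = (a + b) * t" by (simp add: M_inject)
  qed
  then show ?thesis using s by simp
qed

section \<open>Assembling the four corners\<close>

lemma M_peirce: "M a = M (e * a * e) + M (f * a * f) + (M (e * a * f) + M (f * a * e))"
proof -
  have z: "e * (f * x) = 0" "f * (e * x) = 0" "e * (e * x) = e * x" "f * (f * x) = f * x" for x
    by (simp_all add: mult.assoc[symmetric] ee idempotents)
  note simps = z ee idempotents mult.assoc distrib_left distrib_right
  have "M a = M (e * a * e + f * a * f + (e * a * f + f * a * e))"
    using peirce_decomp[of a] by simp
  also have "\<dots> = M (e * a * e + f * a * f) + M (e * a * f + f * a * e)"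
    by (rule M_add_disjoint) (simp_all add: simps)
  also have "M (e * a * e + f * a * f) = M (e * a * e) + M (f * a * f)"
    by (rule M_add_disjoint) (simp_all add: simps)
  \<comment> \<open>These two corners share the off-diagonal part, so disjointness cannot separate
    them.\<close>
  also have "M (e * a * f + f * a * e) = M (e * a * f) + M (f * a * e)"
    by (rule M_add_opposite) (simp_all add: simps)
  finally show ?thesis .
qed

lemma M_add: "M (a + b) = M a + M b"
proof -
  interpret swap: jordan_elementary M K f e by (rule swap)
  have z: "e * (e * x) = e * x" "f * (f * x) = f * x" for x
    by (simp_all add: mult.assoc[symmetric] ee idempotents)
  note simps = z ee idempotents mult.assoc
  have "M (e * a * e + e * b * e) = M (e * a * e) + M (e * b * e)"
    by (rule M_add_ee) (simp_all add: simps)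
  moreover have "M (f * a * f + f * b * f) = M (f * a * f) + M (f * b * f)"
    by (rule swap.M_add_ee) (simp_all add: simps)
  moreover have "M (e * a * f + e * b * f) = M (e * a * f) + M (e * b * f)"
    by (rule M_add_ef) (simp_all add: simps)
  moreover have "M (f * a * e + f * b * e) = M (f * a * e) + M (f * b * e)"
    by (rule swap.M_add_ef) (simp_all add: simps)
  ultimately show ?thesis
    using M_peirce[of a] M_peirce[of b] M_peirce[of "a + b"] by (simp add: algebra_simps)
qed

end

section \<open>Bijectivity of both maps, and transfer of additivity to \<open>Mstar\<close>\<close>

theorem theorem3:
  fixes M :: "'r::ring_1 \<Rightarrow> 's::ring"
    and Mstar :: "'s \<Rightarrow> 'r"
    and e1 e2 :: 'r
  assumes two_torsion_free: "\<forall>a::'r. 2 * a = 0 \<longrightarrow> a = 0"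
    and idem: "e1 * e1 = e1"
    and nontrivial: "e1 \<noteq> 0" "e1 \<noteq> 1"
    and e2: "e2 = 1 - e1"
    and peirce: "\<forall>a::'r. \<forall>ei\<in>{e1, e2}. \<forall>ej\<in>{e1, e2}. \<forall>ek\<in>{e1, e2}.
        {ei * a * ej * r * ek |r. r \<in> UNIV} = {0} \<or> {ek * r * ei * a * ej |r. r \<in> UNIV} = {0}
        \<longrightarrow> ei * a * ej = 0"
    and surj_M: "surj M"
    and surj_Mstar: "surj Mstar"
    and M_eq: "\<forall>a b x. M (a * Mstar x * b + b * Mstar x * a) = M a * x * M b + M b * x * M a"
    and Mstar_eq: "\<forall>x y a. Mstar (x * M a * y + y * M a * x)
        = Mstar x * a * Mstar y + Mstar y * a * Mstar x"
  shows "(\<forall>a b. M (a + b) = M a + M b) \<and> (\<forall>x y. Mstar (x + y) = Mstar x + Mstar y)"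
proof -
  have double_zero: "a = 0" if "a + a = 0" for a :: 'r
    using two_torsion_free[rule_format, of a] that by (simp add: mult_2)
  have double_inject: "a = b" if "a + a = b + b" for a b :: 'r
    using double_zero[of "a - b"] that by (simp add: algebra_simps)
  have M_triple: "M (jtriple a (Mstar x) b) = jtriple (M a) x (M b)" for a b x
    using M_eq by (simp add: jtriple_def)
  have Mstar_triple: "Mstar (jtriple x (M a) y) = jtriple (Mstar x) a (Mstar y)" for x y a
    using Mstar_eq by (simp add: jtriple_def)
  \<comment> \<open>A preimage of 1 lets \<open>M a\<close> determine \<open>a + a\<close>, hence
    \<open>a\<close>; this is injectivity of \<open>M\<close>.\<close>
  obtain u where u: "Mstar u = 1" using surj_Mstar by (metis surjD)
  have unit: "Mstar (jtriple u (M a) u) = a + a" for a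
    by (simp add: Mstar_triple u jtriple_one)
  have inj_M: "inj M"
    by (rule injI) (metis unit double_inject)
  have inj_Mstar: "inj Mstar"
  proof (rule injI)
    fix x y assume eq: "Mstar x = Mstar y"
    obtain a b where ab: "x = M a" "y = M b" using surj_M by (metis surjD)
    obtain v where v: "u = M v" using surj_M by (metis surjD)
    \<comment> \<open>As \<open>u = M v\<close>, the left side is
      \<open>M (jtriple v (Mstar x) v)\<close>, which depends on \<open>x\<close> only through
      \<open>Mstar x\<close>.\<close>
    have "jtriple u x u = jtriple u y u"
      using M_triple[of v x v] M_triple[of v y v] eq v by simp
    then show "x = y" using unit[of a] unit[of b] ab double_inject by metis
  qed
  have inv_left: "inv Mstar (Mstar x) = x" and inv_right: "Mstar (inv Mstar a) = a" for x a
    using inj_Mstar surj_Mstar by (simp_all add: surj_f_inv_f)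
  have peirce': "a = 0"
    if "p \<in> {e1, e2}" "q \<in> {e1, e2}" "k \<in> {e1, e2}" "p * a * q = a" "\<And>r. a * r * k = 0"
    for p q k a
  proof -
    have "{p * a * q * r * k |r. r \<in> UNIV} = {0}" using that(4,5) by simp
    then have "p * a * q = 0" using peirce that(1-3) by blast
    then show ?thesis using that(4) by simp
  qed
  interpret jordan_elementary M "inv Mstar" e1 e2
  proof
    show "bij M" using inj_M surj_M by (rule bijI)
    show "bij (inv Mstar)" using inj_Mstar surj_Mstar by (simp add: bijI bij_imp_bij_inv)
    show "M (jtriple a r b) = jtriple (M a) (inv Mstar r) (M b)" for a r b
      using M_triple[of a "inv Mstar r" b] by (simp add: inv_right)
    show "inv Mstar (jtriple a r b) = jtriple (inv Mstar a) (M r) (inv Mstar b)" for a r b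
      by (metis Mstar_triple inv_left inv_right)
    show "e1 + e2 = 1" by (simp add: e2)
  qed (fact double_zero idem peirce')+
  have "Mstar (x + y) = Mstar x + Mstar y" for x y
  proof -
    \<comment> \<open>Both sides equal {M 1, x, M 1} + {M 1, y, M 1}, the right one by additivity of
      \<open>M\<close>. Injectivity of \<open>M\<close> then leaves twice the claim.\<close>
    have "M (jtriple 1 (Mstar (x + y)) 1) = M (jtriple 1 (Mstar x + Mstar y) 1)"
      by (simp add: M_triple jtriple_add M_add)
    then show ?thesis by - (rule double_inject, simp add: M_inject jtriple_one)
  qed
  then show ?thesis using M_add by blast
qed

end
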